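(* Let $p=(p_0,p_1,p_2,\ldots)$ be a probability distribution on $\mathbb{N}=\{0,1,2,\ldots\}$ that is sub-critical (i.e. $\mu_p=\sum_k kp_k<1$) and unbounded (i.e. the set $\{n;\,p_n>0\}$ is unbounded). Let $\tau$ be a Galton-Watson tree with offspring distribution $p$ and let $M(\tau)$ be its maximal out-degree. Write $F(n)=\sum_{m\le n}p_m$, $\bar F(n)=1-F(n)$, $q_n=\mathbb{P}(M(\tau)=n)$, $H(n)=\mathbb{P}(M(\tau)\le n)$ and $\bar H(n)=1-H(n)$. Then $$\lim_{n\to\infty}\bigl(H(n)\bigr)^n=1$$ and $$\lim_{n\to\infty}\frac{\bar F(n)}{\bar H(n)}=\lim_{n\to\infty}\frac{p_n}{q_n}=1-\mu_p,$$ where the second limit (of $p_n/q_n$) is understood along the infinite subsequence $\{n;\,p_n>0\}$.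
   Context: Let $\mathbb{N}^*=\{1,2,\ldots\}$ and $\mathcal{U}=\bigcup_{n\ge 0}(\mathbb{N}^* )^n$ be the set of finite sequences of positive integers, with $(\mathbb{N}^* )^0=\{\emptyset\}$; $uv$ denotes concatenation. The set of ancestors of $u\in\mathcal{U}$ is $A_u=\{v\in\mathcal{U}:\ u=vw \text{ for some } w\in\mathcal{U},\ w\neq\emptyset\}$. A tree $\mathbf{t}$ is a subset of $\mathcal{U}$ such that: $\emptyset\in\mathbf{t}$; if $u\in\mathbf{t}$ then $A_u\subset\mathbf{t}$; for every $u\in\mathbf{t}$ there is $k_u(\mathbf{t})\in\mathbb{N}\cup\{+\infty\}$ (the out-degree of $u$) such that for every positive integer $i$, $ui\in\mathbf{t}$ iff $1\le i\le k_u(\mathbf{t})$. $\mathbb{T}$ is the set of trees all of whose out-degrees are finite. The maximal out-degree is $M(\mathbf{t})=\sup\{k_u(\mathbf{t});\,u\in\mathbf{t}\}$. A $\mathbb{T}$-valued random variable $\tau$ is a Galton-Watson tree with offspring distribution $p$ if $k_\emptyset(\tau)$ has distribution $p$ and, for every $n\in\mathbb{N}^*$, conditionally on $\{k_\emptyset(\tau)=n\}$, the subtrees $\mathcal{S}_i(\tau)=\{v\in\mathcal{U}:\ iv\in\tau\}$, $1\le i\le n$, are independent and distributed as $\tau$. *)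

theory Defs
  imports "HOL-Probability.Probability"
begin

text \<open>Plane trees in Neveu's formalism: nodes are finite sequences of positive integers.\<close>

definition nodes :: "nat list set" where
  "nodes = {u. \<forall>i\<in>set u. 1 \<le> i}"

definition ancestors :: "nat list \<Rightarrow> nat list set" where
  "ancestors u = {v \<in> nodes. \<exists>w\<in>nodes. w \<noteq> [] \<and> u = v @ w}"

definition has_outdegree :: "nat list set \<Rightarrow> nat list \<Rightarrow> enat \<Rightarrow> bool" where
  "has_outdegree t u k \<longleftrightarrow> (\<forall>i\<ge>1. u @ [i] \<in> t \<longleftrightarrow> enat i \<le> k)"

definition tree :: "nat list set \<Rightarrow> bool" where
  "tree t \<longleftrightarrow> t \<subseteq> nodes \<and> [] \<in> t \<and> (\<forall>u\<in>t. ancestors u \<subseteq> t)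
     \<and> (\<forall>u\<in>t. \<exists>k. has_outdegree t u k)"

definition outdegree :: "nat list set \<Rightarrow> nat list \<Rightarrow> enat" where
  "outdegree t u = (THE k. has_outdegree t u k)"

lemma has_outdegree_unique:
  assumes "has_outdegree t u k" "has_outdegree t u l"
  shows "k = l"
proof -
  have le: "k' \<le> l'" if k': "has_outdegree t u k'" and l': "has_outdegree t u l'" for k' l'
  proof (rule ccontr)
    assume "\<not> k' \<le> l'"
    then obtain m where m: "l' = enat m" and "enat m < k'"
      by (cases l') (auto simp: not_le)
    then have "enat (Suc m) \<le> k'"
      by (simp add: Suc_ile_eq)
    with k' have "u @ [Suc m] \<in> t"
      unfolding has_outdegree_def by auto
    with l' m have "enat (Suc m) \<le> enat m"
      unfolding has_outdegree_def by (metis One_nat_def Suc_le_mono le0)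
    then show False by simp
  qed
  show ?thesis
    using le[OF assms] le[OF assms(2,1)] by simp
qed

lemma outdegree_eqI: "has_outdegree t u k \<Longrightarrow> outdegree t u = k"
  unfolding outdegree_def using has_outdegree_unique by blast

definition locally_finite_trees :: "nat list set set" where
  "locally_finite_trees = {t. tree t \<and> (\<forall>u\<in>t. outdegree t u < \<infinity>)}"

definition max_outdegree :: "nat list set \<Rightarrow> enat" where
  "max_outdegree t = (SUP u\<in>t. outdegree t u)"

definition subtree :: "nat \<Rightarrow> nat list set \<Rightarrow> nat list set" where
  "subtree i t = {v \<in> nodes. i # v \<in> t}"

text \<open>The \<open>\<sigma>\<close>-algebra on the set of locally finite trees is the one generated by the events
  that a given node belongs to the tree; it is the Borel \<open>\<sigma>\<close>-algebra of local convergence.\<close>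

definition tree_space :: "nat list set measure" where
  "tree_space = sigma locally_finite_trees
     ((\<lambda>u. {t \<in> locally_finite_trees. u \<in> t}) ` nodes)"

text \<open>The conditional probability given \<open>A\<close>, as a measure whose underlying space is \<open>A\<close> itself.
  Using \<open>uniform_measure M A\<close>, with underlying space \<open>space M\<close>, would not do: the \<open>i\<close>-th subtree is
  empty, hence not a tree, outside the event that the root has at least \<open>i\<close> children.\<close>

definition conditioned_on :: "'w measure \<Rightarrow> 'w set \<Rightarrow> 'w measure" where
  "conditioned_on M A = uniform_measure (restrict_space M A) A"

text \<open>The branching property is only required for those \<open>n\<close> for which the conditioning event
  has positive probability.\<close>

definition galton_watson_tree ::
  "'w measure \<Rightarrow> ('w \<Rightarrow> nat list set) \<Rightarrow> nat pmf \<Rightarrow> bool" where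
  "galton_watson_tree M \<tau> p \<longleftrightarrow>
     prob_space M \<and>
     \<tau> \<in> measurable M tree_space \<and>
     (\<forall>n. measure M {\<omega> \<in> space M. outdegree (\<tau> \<omega>) [] = enat n} = pmf p n) \<and>
     (\<forall>n\<ge>1. let A = {\<omega> \<in> space M. outdegree (\<tau> \<omega>) [] = enat n} in
        measure M A > 0 \<longrightarrow>
          prob_space.indep_vars (conditioned_on M A) (\<lambda>i. tree_space)
            (\<lambda>i \<omega>. subtree i (\<tau> \<omega>)) {1..n} \<and>
          (\<forall>i\<in>{1..n}. distr (conditioned_on M A) tree_space (\<lambda>\<omega>. subtree i (\<tau> \<omega>))
             = distr M tree_space \<tau>))"

definition offspring_mean :: "nat pmf \<Rightarrow> real" where
  "offspring_mean p = (\<Sum>k. real k * pmf p k)"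

text \<open>Summability is demanded explicitly because \<open>suminf\<close> carries no information about
  divergent series.\<close>

definition subcritical :: "nat pmf \<Rightarrow> bool" where
  "subcritical p \<longleftrightarrow> summable (\<lambda>k. real k * pmf p k) \<and> offspring_mean p < 1"

definition unbounded :: "nat pmf \<Rightarrow> bool" where
  "unbounded p \<longleftrightarrow> \<not> bdd_above {n. pmf p n > 0}"

definition offspring_cdf :: "nat pmf \<Rightarrow> nat \<Rightarrow> real" where
  "offspring_cdf p n = (\<Sum>m\<le>n. pmf p m)"

definition max_outdegree_prob :: "'w measure \<Rightarrow> ('w \<Rightarrow> nat list set) \<Rightarrow> nat \<Rightarrow> real" where
  "max_outdegree_prob M \<tau> n = measure M {\<omega> \<in> space M. max_outdegree (\<tau> \<omega>) = enat n}"

definition max_outdegree_cdf :: "'w measure \<Rightarrow> ('w \<Rightarrow> nat list set) \<Rightarrow> nat \<Rightarrow> real" where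
  "max_outdegree_cdf M \<tau> n = measure M {\<omega> \<in> space M. max_outdegree (\<tau> \<omega>) \<le> enat n}"

end

theory Submission
  imports Defs
begin

text \<open>
  Let \<open>H n\<close> be the probability that no out-degree of the tree exceeds \<open>n\<close>. A tree with root degree
  \<open>k\<close> has this property iff \<open>k \<le> n\<close> and its \<open>k\<close> subtrees at the root have it, so the branching
  property gives the truncated fixed-point equation

    \<open>H n = (\<Sum>k\<le>n. p k * H n ^ k)\<close>   (lemma \<open>max_outdegree_cdf_fixed_point\<close>).

  The rest is real analysis of the sequence \<open>H\<close>. Subtracting the equation from
  \<open>1 = (\<Sum>k\<le>n. p k) + tail n\<close>, or from itself at two consecutive arguments, produces sums
  \<open>\<Sum>k\<le>m. p k * (x ^ k - y ^ k)\<close> with \<open>H m \<le> y \<le> x \<le> 1\<close>. Such a sum is \<open>x - y\<close> times a factor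
  lying between \<open>H m ^ m * (\<Sum>k\<le>m. k * p k)\<close> and \<open>\<Sum>k\<le>m. k * p k\<close>, because each \<open>x ^ k - y ^ k\<close>
  is \<open>x - y\<close> times a sum of \<open>k\<close> monomials in \<open>x\<close> and \<open>y\<close> of degree \<open>k - 1 < m\<close> (lemma \<open>sum_power_diff_factor\<close>).

  The upper bound alone gives \<open>(1 - \<mu>) * (1 - H n) \<le> tail n\<close>, and since \<open>n * tail n\<close> is at most
  \<open>\<Sum>k>n. k * p k\<close>, which vanishes in the limit, Bernoulli's inequality yields \<open>H n ^ n \<longlonglongrightarrow> 1\<close>.
  But then both bounds on the factor tend to \<open>\<mu>\<close>, and the two limits \<open>1 - \<mu>\<close> follow.
  Heuristically, a large maximum is due to a single vertex, and \<open>1 / (1 - \<mu>)\<close>, the expected number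
  of vertices, counts the candidates.
\<close>

section \<open>Analysis of the truncated fixed-point equation\<close>

text \<open>The factor \<open>c\<close> is the weighted sum of the geometric quotients \<open>(x ^ k - y ^ k) / (x - y)\<close>,
  in the form that makes sense for \<open>x = y\<close> too.\<close>

lemma sum_power_diff_factor:
  fixes a :: "nat \<Rightarrow> real"
  assumes a: "\<And>k. 0 \<le> a k" and h: "0 \<le> h" "h \<le> y" and yx: "y \<le> x" and x: "x \<le> 1"
  obtains c where "(\<Sum>k\<le>n. a k * (x ^ k - y ^ k)) = (x - y) * c"
    and "h ^ n * (\<Sum>k\<le>n. real k * a k) \<le> c" and "c \<le> (\<Sum>k\<le>n. real k * a k)"
proof
  define g where "g k = (\<Sum>i<k. y ^ (k - Suc i) * x ^ i)" for k
  let ?c = "\<Sum>k\<le>n. a k * g k"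
  have y: "0 \<le> y" "y \<le> 1" "0 \<le> x" using h yx x by linarith+
  show "(\<Sum>k\<le>n. a k * (x ^ k - y ^ k)) = (x - y) * ?c"
    by (simp add: g_def power_diff_sumr2 sum_distrib_left mult_ac)
  have term_le: "y ^ (k - Suc i) * x ^ i \<le> 1" for k i
    using y x by (intro mult_le_one power_le_one) auto
  have term_ge: "h ^ n \<le> y ^ (k - Suc i) * x ^ i" if "i < k" "k \<le> n" for k i
  proof -
    have "h ^ n \<le> h ^ (k - Suc i + i)"
      using h yx x that by (intro power_decreasing) auto
    also have "\<dots> = h ^ (k - Suc i) * h ^ i" by (rule power_add)
    also have "\<dots> \<le> y ^ (k - Suc i) * x ^ i"
      using h yx y by (intro mult_mono power_mono) auto
    finally show ?thesis .
  qed
  have g_le: "g k \<le> real k" for k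
    using sum_bounded_above[of "{..<k}" "\<lambda>i. y ^ (k - Suc i) * x ^ i" 1] term_le
    by (simp add: g_def)
  have g_ge: "real k * h ^ n \<le> g k" if "k \<le> n" for k
    using sum_bounded_below[of "{..<k}" "h ^ n" "\<lambda>i. y ^ (k - Suc i) * x ^ i"] term_ge that
    by (simp add: g_def)
  have "h ^ n * (\<Sum>k\<le>n. real k * a k) = (\<Sum>k\<le>n. a k * (real k * h ^ n))"
    by (simp add: sum_distrib_left mult_ac)
  also have "\<dots> \<le> ?c"
    using a g_ge by (intro sum_mono mult_left_mono) auto
  finally show "h ^ n * (\<Sum>k\<le>n. real k * a k) \<le> ?c" .
  have "?c \<le> (\<Sum>k\<le>n. a k * real k)"
    using a g_le by (intro sum_mono mult_left_mono) auto
  then show "?c \<le> (\<Sum>k\<le>n. real k * a k)" by (simp add: mult.commute)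
qed

lemma offspring_cdf_le_1: "offspring_cdf p n \<le> 1"
  using measure_pmf.prob_le_1[of p "{..n}"]
  by (simp add: offspring_cdf_def measure_measure_pmf_finite)

lemma offspring_cdf_tendsto_1: "offspring_cdf p \<longlonglongrightarrow> 1"
proof -
  have "(\<lambda>n. measure (measure_pmf p) {..n}) \<longlonglongrightarrow> measure (measure_pmf p) (\<Union>n. {..n})"
    by (intro measure_pmf.finite_Lim_measure_incseq) (auto simp: incseq_def)
  moreover have "(\<Union>n. {..n::nat}) = UNIV" by auto
  ultimately show ?thesis
    using measure_pmf.prob_space[of p]
    by (simp add: offspring_cdf_def[abs_def] measure_measure_pmf_finite)
qed

lemma offspring_cdf_less_1:
  assumes "unbounded p"
  shows "offspring_cdf p n < 1"
proof -
  obtain k where k: "pmf p k > 0" "n < k"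
    using assms unfolding unbounded_def bdd_above_def by (auto simp: not_le)
  have "offspring_cdf p n < offspring_cdf p n + pmf p k" using k by simp
  also have "\<dots> = (\<Sum>m\<in>insert k {..n}. pmf p m)"
    using k by (simp add: offspring_cdf_def)
  also have "\<dots> \<le> (\<Sum>m\<le>k. pmf p m)"
    using k by (intro sum_mono2) auto
  also have "\<dots> \<le> 1" using offspring_cdf_le_1[of p k] by (simp add: offspring_cdf_def)
  finally show ?thesis .
qed

definition truncated_mean :: "nat pmf \<Rightarrow> nat \<Rightarrow> real" where
  "truncated_mean p n = (\<Sum>k\<le>n. real k * pmf p k)"

lemma truncated_mean_tendsto:
  assumes "subcritical p"
  shows "truncated_mean p \<longlonglongrightarrow> offspring_mean p"
  using summable_LIMSEQ'[of "\<lambda>k. real k * pmf p k"] assms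
  by (simp add: subcritical_def truncated_mean_def[abs_def] offspring_mean_def)

lemma truncated_mean_le:
  assumes "subcritical p"
  shows "truncated_mean p n \<le> offspring_mean p"
  unfolding truncated_mean_def offspring_mean_def
  by (rule sum_le_suminf) (use assms in \<open>auto simp: subcritical_def\<close>)

text \<open>Markov's inequality for the tail of the mean. It is first proved between \<open>n\<close> and a finite
  cut-off \<open>N\<close>, where it is a comparison of finite sums, and then \<open>N\<close> tends to infinity.\<close>

lemma offspring_tail_le:
  assumes "subcritical p"
  shows "real n * (1 - offspring_cdf p n) \<le> offspring_mean p - truncated_mean p n"
proof (rule LIMSEQ_le)
  show "(\<lambda>N. real n * (offspring_cdf p N - offspring_cdf p n))
      \<longlonglongrightarrow> real n * (1 - offspring_cdf p n)"
    by (intro tendsto_intros offspring_cdf_tendsto_1)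
  show "(\<lambda>N. truncated_mean p N - truncated_mean p n)
      \<longlonglongrightarrow> offspring_mean p - truncated_mean p n"
    by (intro tendsto_intros truncated_mean_tendsto assms)
  show "\<exists>N0. \<forall>N\<ge>N0. real n * (offspring_cdf p N - offspring_cdf p n)
      \<le> truncated_mean p N - truncated_mean p n"
  proof (intro exI allI impI)
    fix N assume "n \<le> N"
    then have split: "(\<Sum>k\<le>N. f k) - (\<Sum>k\<le>n. f k) = (\<Sum>k\<in>{n<..N}. f k)" for f :: "nat \<Rightarrow> real"
      by (subst sum_diff[symmetric]) (auto intro!: sum.cong)
    have "real n * (offspring_cdf p N - offspring_cdf p n) = (\<Sum>k\<in>{n<..N}. real n * pmf p k)"
      by (simp add: offspring_cdf_def split sum_distrib_left)
    also have "\<dots> \<le> (\<Sum>k\<in>{n<..N}. real k * pmf p k)"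
      by (intro sum_mono mult_right_mono) auto
    also have "\<dots> = truncated_mean p N - truncated_mean p n"
      by (simp add: truncated_mean_def split)
    finally show "real n * (offspring_cdf p N - offspring_cdf p n)
      \<le> truncated_mean p N - truncated_mean p n" .
  qed
qed

locale truncated_fixed_point =
  fixes p :: "nat pmf" and H :: "nat \<Rightarrow> real"
  assumes subcritical: "subcritical p"
    and H_nonneg: "0 \<le> H n"
    and H_le_1: "H n \<le> 1"
    and H_mono: "m \<le> n \<Longrightarrow> H m \<le> H n"
    and H_eq: "H n = (\<Sum>k\<le>n. pmf p k * H n ^ k)"
begin

lemma mean_less_1: "offspring_mean p < 1"
  using subcritical by (simp add: subcritical_def)

lemma H_tail_factor:
  "\<exists>c. 1 - offspring_cdf p n = (1 - H n) * (1 - c) \<and>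
    H n ^ n * truncated_mean p n \<le> c \<and> c \<le> truncated_mean p n"
proof -
  obtain c where c: "(\<Sum>k\<le>n. pmf p k * (1 ^ k - H n ^ k)) = (1 - H n) * c"
    and bounds: "H n ^ n * truncated_mean p n \<le> c" "c \<le> truncated_mean p n"
    using sum_power_diff_factor[of "pmf p" "H n" "H n" 1 n] H_nonneg H_le_1
    by (auto simp: truncated_mean_def)
  have "(\<Sum>k\<le>n. pmf p k * (1 ^ k - H n ^ k)) = offspring_cdf p n - H n"
    by (subst (2) H_eq) (simp add: offspring_cdf_def algebra_simps sum_subtractf)
  with c have "1 - offspring_cdf p n = (1 - H n) * (1 - c)"
    by (simp add: algebra_simps)
  with bounds show ?thesis by blast
qed

lemma H_increment_factor:
  "\<exists>c. (H (Suc m) - H m) * (1 - c) = pmf p (Suc m) * H (Suc m) ^ Suc m \<and>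
    H m ^ m * truncated_mean p m \<le> c \<and> c \<le> truncated_mean p m"
proof -
  obtain c where c: "(\<Sum>k\<le>m. pmf p k * (H (Suc m) ^ k - H m ^ k)) = (H (Suc m) - H m) * c"
    and bounds: "H m ^ m * truncated_mean p m \<le> c" "c \<le> truncated_mean p m"
    using sum_power_diff_factor[of "pmf p" "H m" "H m" "H (Suc m)" m]
      H_nonneg H_le_1 H_mono[of m "Suc m"]
    by (auto simp: truncated_mean_def)
  have "H (Suc m) = (\<Sum>k\<le>m. pmf p k * H (Suc m) ^ k) + pmf p (Suc m) * H (Suc m) ^ Suc m"
    using H_eq[of "Suc m"] by simp
  moreover have "H m = (\<Sum>k\<le>m. pmf p k * H m ^ k)" by (rule H_eq)
  ultimately have "H (Suc m) - H m = (\<Sum>k\<le>m. pmf p k * (H (Suc m) ^ k - H m ^ k))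
      + pmf p (Suc m) * H (Suc m) ^ Suc m"
    by (simp add: right_diff_distrib sum_subtractf)
  moreover have "(H (Suc m) - H m) * (1 - c)
      = H (Suc m) - H m - (\<Sum>k\<le>m. pmf p k * (H (Suc m) ^ k - H m ^ k))"
    unfolding c by (simp add: right_diff_distrib)
  ultimately have "(H (Suc m) - H m) * (1 - c) = pmf p (Suc m) * H (Suc m) ^ Suc m"
    by linarith
  with bounds show ?thesis by blast
qed

text \<open>Subcriticality enters here: as \<open>\<mu> < 1\<close>, this bounds \<open>1 - H n\<close> by a constant multiple of the
  offspring tail, so that \<open>H\<close> tends to the fixed point 1 and no other.\<close>

lemma H_tail_le: "(1 - offspring_mean p) * (1 - H n) \<le> 1 - offspring_cdf p n"
proof -
  obtain c where "1 - offspring_cdf p n = (1 - H n) * (1 - c)" "c \<le> truncated_mean p n"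
    using H_tail_factor[of n] by blast
  moreover have "(1 - H n) * (1 - offspring_mean p) \<le> (1 - H n) * (1 - c)"
    using calculation truncated_mean_le[OF subcritical, of n] H_le_1[of n]
    by (intro mult_left_mono) auto
  ultimately show ?thesis by (simp add: mult.commute)
qed

lemma H_power_tendsto_1: "(\<lambda>n. H n ^ n) \<longlonglongrightarrow> 1"
proof (rule tendsto_sandwich)
  let ?d = "\<lambda>n. (offspring_mean p - truncated_mean p n) / (1 - offspring_mean p)"
  have "1 - ?d n \<le> H n ^ n" for n
  proof -
    have "(1 - offspring_mean p) * (real n * (1 - H n)) \<le> real n * (1 - offspring_cdf p n)"
      using mult_left_mono[OF H_tail_le, of "real n" n] by (simp add: mult_ac)
    also have "\<dots> \<le> offspring_mean p - truncated_mean p n"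
      by (rule offspring_tail_le[OF subcritical])
    finally have "real n * (1 - H n) \<le> ?d n"
      using mean_less_1 by (simp add: pos_le_divide_eq mult_ac)
    moreover have "1 + real n * (H n - 1) \<le> H n ^ n"
      using Bernoulli_inequality[of "H n - 1" n] H_nonneg[of n] by simp
    ultimately show ?thesis by (simp add: algebra_simps)
  qed
  then show "\<forall>\<^sub>F n in sequentially. 1 - ?d n \<le> H n ^ n" by simp
  show "\<forall>\<^sub>F n in sequentially. H n ^ n \<le> 1"
    by (simp add: power_le_one H_nonneg H_le_1)
  have "(\<lambda>n. 1 - ?d n) \<longlonglongrightarrow> 1 - (offspring_mean p - offspring_mean p) / (1 - offspring_mean p)"
    using mean_less_1 by (intro tendsto_intros truncated_mean_tendsto subcritical) auto
  then show "(\<lambda>n. 1 - ?d n) \<longlonglongrightarrow> 1" by simp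
qed simp

lemma factor_tendsto_mean:
  assumes "\<And>n. H n ^ n * truncated_mean p n \<le> c n" and "\<And>n. c n \<le> truncated_mean p n"
  shows "c \<longlonglongrightarrow> offspring_mean p"
proof (rule tendsto_sandwich)
  have "(\<lambda>n. H n ^ n * truncated_mean p n) \<longlonglongrightarrow> 1 * offspring_mean p"
    by (intro tendsto_intros H_power_tendsto_1 truncated_mean_tendsto subcritical)
  then show "(\<lambda>n. H n ^ n * truncated_mean p n) \<longlonglongrightarrow> offspring_mean p" by simp
  show "truncated_mean p \<longlonglongrightarrow> offspring_mean p"
    by (rule truncated_mean_tendsto[OF subcritical])
qed (use assms in simp_all)

lemma tail_ratio_tendsto:
  assumes "unbounded p"
  shows "(\<lambda>n. (1 - offspring_cdf p n) / (1 - H n)) \<longlonglongrightarrow> 1 - offspring_mean p"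
proof -
  have "\<forall>n. \<exists>c. 1 - offspring_cdf p n = (1 - H n) * (1 - c) \<and>
      H n ^ n * truncated_mean p n \<le> c \<and> c \<le> truncated_mean p n"
    by (intro allI H_tail_factor)
  from choice[OF this] obtain c where c: "\<And>n. 1 - offspring_cdf p n = (1 - H n) * (1 - c n)"
    and bounds: "\<And>n. H n ^ n * truncated_mean p n \<le> c n" "\<And>n. c n \<le> truncated_mean p n"
    by blast
  have "(1 - offspring_cdf p n) / (1 - H n) = 1 - c n" for n
  proof -
    have "1 - H n \<noteq> 0"
      using c[of n] offspring_cdf_less_1[OF assms, of n] by auto
    then show ?thesis by (simp add: c)
  qed
  moreover have "(\<lambda>n. 1 - c n) \<longlonglongrightarrow> 1 - offspring_mean p"
    by (intro tendsto_intros factor_tendsto_mean bounds)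
  ultimately show ?thesis by simp
qed

text \<open>The increments of \<open>H\<close> are the probabilities \<open>q\<close> of the values of the maximum. Solving
  \<open>q n * (1 - c) = p n * H n ^ n\<close> for the ratio divides by \<open>q n\<close>, which is nonzero where \<open>p n\<close> is;
  so the auxiliary sequence \<open>f\<close> in the proof converges along all \<open>n\<close> and eventually agrees with the ratio
  along \<open>r\<close>.\<close>

lemma increment_ratio_tendsto:
  assumes r: "strict_mono r" and pos: "\<And>j. pmf p (r j) > 0"
    and q: "\<And>m. q (Suc m) = H (Suc m) - H m"
  shows "(\<lambda>j. pmf p (r j) / q (r j)) \<longlonglongrightarrow> 1 - offspring_mean p"
proof -
  have "\<forall>m. \<exists>c. (H (Suc m) - H m) * (1 - c) = pmf p (Suc m) * H (Suc m) ^ Suc m \<and>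
      H m ^ m * truncated_mean p m \<le> c \<and> c \<le> truncated_mean p m"
    by (intro allI H_increment_factor)
  from choice[OF this] obtain c where c: "\<And>m. (H (Suc m) - H m) * (1 - c m) = pmf p (Suc m) * H (Suc m) ^ Suc m"
    and bounds: "\<And>n. H n ^ n * truncated_mean p n \<le> c n" "\<And>n. c n \<le> truncated_mean p n"
    by blast
  \<comment> \<open>The factor belonging to the increment from \<open>n - 1\<close> to \<open>n\<close> is indexed by \<open>n - 1\<close>; the
    meaningless value at \<open>n = 0\<close> is skipped below.\<close>
  define f where "f n = (1 - c (n - 1)) / H n ^ n" for n
  have "(\<lambda>n. c (n - 1)) \<longlonglongrightarrow> offspring_mean p"
    by (rule LIMSEQ_imp_Suc) (use factor_tendsto_mean[OF bounds] in simp)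
  then have "f \<longlonglongrightarrow> (1 - offspring_mean p) / 1"
    unfolding f_def[abs_def] by (intro tendsto_intros H_power_tendsto_1) auto
  then have "(\<lambda>j. f (r j)) \<longlonglongrightarrow> 1 - offspring_mean p"
    using filterlim_compose[OF _ filterlim_subseq[OF r]] by simp
  moreover have "\<forall>\<^sub>F j in sequentially. f (r j) = pmf p (r j) / q (r j)"
  proof -
    have "\<forall>\<^sub>F n in sequentially. 0 < H n ^ n"
      using order_tendstoD(1)[OF H_power_tendsto_1, of 0] by simp
    then have "\<forall>\<^sub>F n in sequentially. 0 < n \<and> 0 < H n ^ n"
      using eventually_gt_at_top[of 0] by eventually_elim simp
    then have "\<forall>\<^sub>F j in sequentially. 0 < r j \<and> 0 < H (r j) ^ r j"
      using filterlim_subseq[OF r] by (rule eventually_compose_filterlim)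
    then show ?thesis
    proof eventually_elim
      case (elim j)
      then obtain m where m: "r j = Suc m" by (cases "r j") auto
      have "q (Suc m) * (1 - c m) = pmf p (Suc m) * H (Suc m) ^ Suc m"
        using c[of m] q by simp
      moreover have "0 < pmf p (Suc m)" "0 < H (Suc m) ^ Suc m"
        using elim pos[of j] m by simp_all
      moreover from calculation have "q (Suc m) \<noteq> 0" "H (Suc m) ^ Suc m \<noteq> 0" by auto
      ultimately show ?case
        by (simp add: f_def m frac_eq_eq mult.commute[of "1 - c m"] del: power_Suc power_eq_0_iff)
    qed
  qed
  ultimately show ?thesis by (rule Lim_transform_eventually)
qed

end

section \<open>The branching equation for the maximal out-degree\<close>

lemma has_outdegree_outdegree:
  assumes "tree t" and "u \<in> t"
  shows "has_outdegree t u (outdegree t u)"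
  using assms by (metis tree_def outdegree_eqI)

lemma outdegree_le_iff:
  assumes "tree t" and "u \<in> t"
  shows "outdegree t u \<le> enat n \<longleftrightarrow> u @ [Suc n] \<notin> t"
proof -
  have "u @ [Suc n] \<in> t \<longleftrightarrow> enat (Suc n) \<le> outdegree t u"
    using has_outdegree_outdegree[OF assms] by (simp add: has_outdegree_def)
  then show ?thesis by (simp add: Suc_ile_eq not_less)
qed

lemma tree_prefix:
  assumes t: "tree t" and "u @ w \<in> t"
  shows "u \<in> t"
proof (cases "w = []")
  case False
  have "u @ w \<in> nodes" using assms by (auto simp: tree_def)
  then have "u \<in> ancestors (u @ w)" using False by (auto simp: ancestors_def nodes_def)
  then show ?thesis using assms unfolding tree_def by blast
qed (use assms in simp)

text \<open>Since the children of a vertex are numbered consecutively, a large out-degree is witnessed by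
  a single node. This turns the supremum into countably many generating events.\<close>

lemma max_outdegree_le_iff:
  assumes t: "tree t"
  shows "max_outdegree t \<le> enat n \<longleftrightarrow> (\<forall>u\<in>nodes. u @ [Suc n] \<notin> t)"
proof -
  have "t \<subseteq> nodes" using t by (simp add: tree_def)
  then show ?thesis
    using outdegree_le_iff[OF t] tree_prefix[OF t]
    by (auto simp: max_outdegree_def SUP_le_iff)
qed

text \<open>Read through witnessing nodes, a forbidden node \<open>u @ [Suc n]\<close> either has \<open>u = []\<close> and concerns
  the root degree, or lies in the subtree at the first letter of \<open>u\<close>.\<close>

lemma max_outdegree_le_iff_subtrees:
  assumes t: "tree t" and deg: "outdegree t [] = enat k"
    and sub: "\<And>i. i \<in> {1..k} \<Longrightarrow> tree (subtree i t)"
  shows "max_outdegree t \<le> enat n \<longleftrightarrow>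
    k \<le> n \<and> (\<forall>i\<in>{1..k}. max_outdegree (subtree i t) \<le> enat n)"
proof -
  have root: "[] \<in> t" using t by (simp add: tree_def)
  have child: "i \<in> {1..k}" if "i # v \<in> t" for i v
  proof -
    have "[i] \<in> t" using tree_prefix[OF t, of "[i]" v] that by simp
    moreover have "1 \<le> i" using t that by (auto simp: tree_def nodes_def)
    ultimately show ?thesis
      using has_outdegree_outdegree[OF t root] by (simp add: deg has_outdegree_def)
  qed
  have "max_outdegree t \<le> enat n \<longleftrightarrow>
      [Suc n] \<notin> t \<and> (\<forall>i v. i # v \<in> nodes \<longrightarrow> i # v @ [Suc n] \<notin> t)"
    unfolding max_outdegree_le_iff[OF t]
  proof safe
    assume *: "\<forall>u\<in>nodes. u @ [Suc n] \<notin> t"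
    show "False" if "[Suc n] \<in> t" using *[rule_format, of "[]"] that by (simp add: nodes_def)
    show "False" if "i # v \<in> nodes" "i # v @ [Suc n] \<in> t" for i v
      using *[rule_format, of "i # v"] that by simp
  next
    fix u assume "[Suc n] \<notin> t" "\<forall>i v. i # v \<in> nodes \<longrightarrow> i # v @ [Suc n] \<notin> t"
      and "u \<in> nodes" "u @ [Suc n] \<in> t"
    then show False by (cases u) auto
  qed
  also have "[Suc n] \<notin> t \<longleftrightarrow> k \<le> n"
    using outdegree_le_iff[OF t root, of n] deg by simp
  also have "(\<forall>i v. i # v \<in> nodes \<longrightarrow> i # v @ [Suc n] \<notin> t) \<longleftrightarrow>
      (\<forall>i\<in>{1..k}. max_outdegree (subtree i t) \<le> enat n)"
  proof -
    have "max_outdegree (subtree i t) \<le> enat n \<longleftrightarrow> (\<forall>v\<in>nodes. i # v @ [Suc n] \<notin> t)"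
      if "i \<in> {1..k}" for i
      using max_outdegree_le_iff[OF sub[OF that], of n] by (auto simp: subtree_def nodes_def)
    moreover have "(\<forall>i v. i # v \<in> nodes \<longrightarrow> i # v @ [Suc n] \<notin> t) \<longleftrightarrow>
        (\<forall>i\<in>{1..k}. \<forall>v\<in>nodes. i # v @ [Suc n] \<notin> t)"
      using child by (fastforce simp: nodes_def)
    ultimately show ?thesis by simp
  qed
  finally show ?thesis .
qed

lemma space_tree_space: "space tree_space = locally_finite_trees"
  unfolding tree_space_def by (rule space_measure_of) auto

lemma sets_tree_space_node:
  assumes "u \<in> nodes"
  shows "{t \<in> locally_finite_trees. u \<in> t} \<in> sets tree_space"
proof -
  have "sets tree_space = sigma_sets locally_finite_trees
      ((\<lambda>u. {t \<in> locally_finite_trees. u \<in> t}) ` nodes)"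
    unfolding tree_space_def by (rule sets_measure_of) auto
  then show ?thesis using assms by auto
qed

lemma sets_tree_space_max_outdegree_le:
  "{t \<in> locally_finite_trees. max_outdegree t \<le> enat n} \<in> sets tree_space"
proof -
  have "{t \<in> locally_finite_trees. max_outdegree t \<le> enat n} =
      space tree_space - (\<Union>u\<in>nodes. {t \<in> locally_finite_trees. u @ [Suc n] \<in> t})"
    using max_outdegree_le_iff by (auto simp: space_tree_space locally_finite_trees_def)
  also have "\<dots> \<in> sets tree_space"
    by (intro sets.Diff sets.top sets.countable_UN')
      (auto intro!: sets_tree_space_node simp: nodes_def)
  finally show ?thesis .
qed

lemma sets_tree_space_root_outdegree_le:
  "{t \<in> locally_finite_trees. outdegree t [] \<le> enat n} \<in> sets tree_space"
proof -
  have "{t \<in> locally_finite_trees. outdegree t [] \<le> enat n} =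
      space tree_space - {t \<in> locally_finite_trees. [Suc n] \<in> t}"
    using outdegree_le_iff[of _ "[]" n]
    by (auto simp: space_tree_space locally_finite_trees_def tree_def)
  also have "\<dots> \<in> sets tree_space"
    by (intro sets.Diff sets.top sets_tree_space_node) (auto simp: nodes_def)
  finally show ?thesis .
qed

lemma sets_tree_space_root_outdegree_eq:
  "{t \<in> locally_finite_trees. outdegree t [] = enat k} \<in> sets tree_space"
proof (cases k)
  case 0
  then have "{t \<in> locally_finite_trees. outdegree t [] = enat k} =
      {t \<in> locally_finite_trees. outdegree t [] \<le> enat 0}"
    by (auto simp: zero_enat_def[symmetric])
  then show ?thesis using sets_tree_space_root_outdegree_le by simp
next
  case (Suc m)
  have "x = enat (Suc m) \<longleftrightarrow> x \<le> enat (Suc m) \<and> \<not> x \<le> enat m" for x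
    by (cases x) auto
  then have "{t \<in> locally_finite_trees. outdegree t [] = enat k} =
      {t \<in> locally_finite_trees. outdegree t [] \<le> enat (Suc m)} -
      {t \<in> locally_finite_trees. outdegree t [] \<le> enat m}"
    using Suc by auto
  then show ?thesis using sets_tree_space_root_outdegree_le by (simp add: sets.Diff)
qed

lemma space_conditioned_on:
  assumes "A \<subseteq> space M"
  shows "space (conditioned_on M A) = A"
  using assms by (auto simp: conditioned_on_def space_restrict_space)

context prob_space
begin

lemma conditioned_on:
  assumes A: "A \<in> events" "prob A > 0"
  shows prob_space_conditioned_on: "prob_space (conditioned_on M A)"
    and measure_conditioned_on:
      "\<And>B. B \<in> events \<Longrightarrow> B \<subseteq> A \<Longrightarrow> measure (conditioned_on M A) B = prob B / prob A"
proof -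
  have meas: "measure (restrict_space M A) B = prob B" "emeasure (restrict_space M A) B = prob B"
    if "B \<subseteq> A" for B
    using A that by (auto simp: measure_restrict_space emeasure_restrict_space emeasure_eq_measure)
  have A': "emeasure (restrict_space M A) A \<noteq> 0" "emeasure (restrict_space M A) A \<noteq> \<infinity>"
    using A meas[of A] by auto
  then show "prob_space (conditioned_on M A)"
    unfolding conditioned_on_def by (rule prob_space_uniform_measure)
  fix B assume B: "B \<in> events" "B \<subseteq> A"
  then have "B \<in> sets (restrict_space M A)"
    using A by (subst sets_restrict_space_iff) auto
  with A' B show "measure (conditioned_on M A) B = prob B / prob A"
    by (simp add: conditioned_on_def meas Int_absorb1)
qed

end

locale galton_watson = prob_space M for M :: "'w measure" +
  fixes \<tau> :: "'w \<Rightarrow> nat list set" and p :: "nat pmf"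
  assumes galton_watson_tree: "galton_watson_tree M \<tau> p"
begin

definition bounded_event :: "nat \<Rightarrow> 'w set" where
  "bounded_event n = {\<omega> \<in> space M. max_outdegree (\<tau> \<omega>) \<le> enat n}"

definition root_event :: "nat \<Rightarrow> 'w set" where
  "root_event k = {\<omega> \<in> space M. outdegree (\<tau> \<omega>) [] = enat k}"

lemma \<tau>_measurable: "\<tau> \<in> measurable M tree_space"
  using galton_watson_tree by (simp add: galton_watson_tree_def)

lemma \<tau>_tree: "\<omega> \<in> space M \<Longrightarrow> \<tau> \<omega> \<in> locally_finite_trees"
  using measurable_space[OF \<tau>_measurable] by (simp add: space_tree_space)

lemma tree_event:
  assumes "{t \<in> locally_finite_trees. P t} \<in> sets tree_space"
  shows "{\<omega> \<in> space M. P (\<tau> \<omega>)} \<in> events"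
proof -
  have "{\<omega> \<in> space M. P (\<tau> \<omega>)} = \<tau> -` {t \<in> locally_finite_trees. P t} \<inter> space M"
    using \<tau>_tree by auto
  then show ?thesis using measurable_sets[OF \<tau>_measurable assms] by simp
qed

lemma bounded_event_measurable: "bounded_event n \<in> events"
  unfolding bounded_event_def by (intro tree_event sets_tree_space_max_outdegree_le)

lemma root_event_measurable: "root_event k \<in> events"
  unfolding root_event_def by (intro tree_event sets_tree_space_root_outdegree_eq)

lemma prob_root_event: "prob (root_event k) = pmf p k"
  using galton_watson_tree by (simp add: galton_watson_tree_def root_event_def)

lemma prob_bounded_event: "prob (bounded_event n) = max_outdegree_cdf M \<tau> n"
  by (simp add: bounded_event_def max_outdegree_cdf_def)

lemma root_degree_le_max:
  assumes "\<omega> \<in> space M"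
  shows "outdegree (\<tau> \<omega>) [] \<le> max_outdegree (\<tau> \<omega>)"
  using \<tau>_tree[OF assms]
  by (auto simp: max_outdegree_def locally_finite_trees_def tree_def intro: SUP_upper)

text \<open>For \<open>k \<ge> 1\<close> of positive probability, the event is, under the conditional law, an intersection
  of independent events on the subtrees, each distributed as the tree. The branching property is
  silent on the other two cases: if \<open>p k = 0\<close> both sides vanish, and if the root is a leaf the
  maximum is 0, so the bound \<open>n\<close> holds automatically, matching the factor \<open>H n ^ 0 = 1\<close>.\<close>

lemma prob_bounded_inter_root:
  assumes kn: "k \<le> n"
  shows "prob (bounded_event n \<inter> root_event k) = pmf p k * max_outdegree_cdf M \<tau> n ^ k"
proof -
  consider "pmf p k = 0" | "k = 0" | "pmf p k > 0" "k \<ge> 1"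
    using pmf_nonneg[of p k] by linarith
  then show ?thesis
  proof cases
    case 1
    then have "prob (bounded_event n \<inter> root_event k) \<le> 0"
      using finite_measure_mono[of "bounded_event n \<inter> root_event k" "root_event k"]
        root_event_measurable prob_root_event by simp
    then show ?thesis using 1 measure_nonneg[of M] by (simp add: order_antisym)
  next
    case 2
    have "root_event 0 \<subseteq> bounded_event n"
      using \<tau>_tree max_outdegree_le_iff_subtrees[of _ 0 n]
      by (auto simp: root_event_def bounded_event_def locally_finite_trees_def)
    then show ?thesis using 2 prob_root_event[of 0] by (simp add: Int_absorb1)
  next
    case 3
    define A where "A = root_event k"
    define C where "C = conditioned_on M A"
    define L where "L = {t \<in> locally_finite_trees. max_outdegree t \<le> enat n}"
    have A: "A \<in> events" "prob A = pmf p k"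
      by (simp_all add: A_def root_event_measurable prob_root_event)
    have L: "L \<in> sets tree_space"
      by (simp add: L_def sets_tree_space_max_outdegree_le)
    interpret C: prob_space C
      unfolding C_def by (rule prob_space_conditioned_on) (use A 3 in auto)
    have spC: "space C = A"
      unfolding C_def using A sets.sets_into_space by (intro space_conditioned_on) auto
    have indep: "C.indep_vars (\<lambda>i. tree_space) (\<lambda>i \<omega>. subtree i (\<tau> \<omega>)) {1..k}"
      and dist: "\<And>i. i \<in> {1..k} \<Longrightarrow>
        distr C tree_space (\<lambda>\<omega>. subtree i (\<tau> \<omega>)) = distr M tree_space \<tau>"
      using galton_watson_tree 3 A
      by (auto simp: galton_watson_tree_def Let_def C_def A_def root_event_def)
    have rv: "(\<lambda>\<omega>. subtree i (\<tau> \<omega>)) \<in> measurable C tree_space" if "i \<in> {1..k}" for i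
      using indep that by (simp add: C.indep_vars_def)
    \<comment> \<open>Measurability into the space of trees already says that these subtrees are trees.\<close>
    have sub: "subtree i (\<tau> \<omega>) \<in> locally_finite_trees" if "i \<in> {1..k}" "\<omega> \<in> A" for i \<omega>
      using measurable_space[OF rv[OF that(1)]] that(2) by (simp add: spC space_tree_space)
    have "bounded_event n \<inter> A = (\<Inter>i\<in>{1..k}. (\<lambda>\<omega>. subtree i (\<tau> \<omega>)) -` L \<inter> space C)"
    proof -
      have "\<omega> \<in> bounded_event n \<longleftrightarrow> (\<forall>i\<in>{1..k}. subtree i (\<tau> \<omega>) \<in> L)" if "\<omega> \<in> A" for \<omega>
        using that kn \<tau>_tree[of \<omega>] sub max_outdegree_le_iff_subtrees[of "\<tau> \<omega>" k n]
        by (auto simp: A_def root_event_def bounded_event_def L_def locally_finite_trees_def)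
      then show ?thesis using 3 by (auto simp: spC)
    qed
    then have "C.prob (bounded_event n \<inter> A)
        = (\<Prod>i\<in>{1..k}. C.prob ((\<lambda>\<omega>. subtree i (\<tau> \<omega>)) -` L \<inter> space C))"
      using C.indep_varsD_finite[OF indep, of "\<lambda>_. L"] 3 L by simp
    also have "\<dots> = (\<Prod>i\<in>{1..k}. max_outdegree_cdf M \<tau> n)"
    proof (rule prod.cong[OF refl])
      fix i assume i: "i \<in> {1..k}"
      have "C.prob ((\<lambda>\<omega>. subtree i (\<tau> \<omega>)) -` L \<inter> space C)
          = measure (distr C tree_space (\<lambda>\<omega>. subtree i (\<tau> \<omega>))) L"
        by (rule measure_distr[OF rv[OF i] L, symmetric])
      also have "\<dots> = prob (\<tau> -` L \<inter> space M)"
        unfolding dist[OF i] by (rule measure_distr[OF \<tau>_measurable L])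
      also have "\<tau> -` L \<inter> space M = bounded_event n"
        using \<tau>_tree by (auto simp: L_def bounded_event_def)
      finally show "C.prob ((\<lambda>\<omega>. subtree i (\<tau> \<omega>)) -` L \<inter> space C) = max_outdegree_cdf M \<tau> n"
        by (simp add: prob_bounded_event)
    qed
    also have "\<dots> = max_outdegree_cdf M \<tau> n ^ k" by simp
    also have "C.prob (bounded_event n \<inter> A) = prob (bounded_event n \<inter> A) / prob A"
      unfolding C_def
      by (rule measure_conditioned_on) (use A 3 bounded_event_measurable in auto)
    finally show ?thesis using A 3 by (simp add: A_def field_simps)
  qed
qed

lemma max_outdegree_cdf_fixed_point:
  "max_outdegree_cdf M \<tau> n = (\<Sum>k\<le>n. pmf p k * max_outdegree_cdf M \<tau> n ^ k)"
proof -
  have "bounded_event n = (\<Union>k\<le>n. bounded_event n \<inter> root_event k)"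
  proof safe
    fix \<omega> assume w: "\<omega> \<in> bounded_event n"
    then have sp: "\<omega> \<in> space M" by (simp add: bounded_event_def)
    have "outdegree (\<tau> \<omega>) [] \<le> enat n"
      using w root_degree_le_max[OF sp] by (auto simp: bounded_event_def)
    then obtain k where "outdegree (\<tau> \<omega>) [] = enat k" "k \<le> n"
      by (cases "outdegree (\<tau> \<omega>) []") auto
    then show "\<omega> \<in> (\<Union>k\<le>n. bounded_event n \<inter> root_event k)"
      using w sp by (auto simp: root_event_def)
  qed
  then have "prob (bounded_event n) = prob (\<Union>k\<le>n. bounded_event n \<inter> root_event k)" by simp
  also have "\<dots> = (\<Sum>k\<le>n. prob (bounded_event n \<inter> root_event k))"
    using bounded_event_measurable root_event_measurable
    by (intro finite_measure_finite_Union) (auto simp: disjoint_family_on_def root_event_def)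
  finally show ?thesis by (simp add: prob_bounded_event prob_bounded_inter_root)
qed

lemma bounded_event_mono: "m \<le> n \<Longrightarrow> bounded_event m \<subseteq> bounded_event n"
  by (auto simp: bounded_event_def intro: order_trans)

lemma max_outdegree_prob_Suc:
  "max_outdegree_prob M \<tau> (Suc m) = max_outdegree_cdf M \<tau> (Suc m) - max_outdegree_cdf M \<tau> m"
proof -
  have "x = enat (Suc m) \<longleftrightarrow> x \<le> enat (Suc m) \<and> \<not> x \<le> enat m" for x
    by (cases x) auto
  then have "{\<omega> \<in> space M. max_outdegree (\<tau> \<omega>) = enat (Suc m)} = bounded_event (Suc m) - bounded_event m"
    by (auto simp: bounded_event_def)
  then show ?thesis
    using finite_measure_Diff[OF bounded_event_measurable bounded_event_measurable
        bounded_event_mono[of m "Suc m"]]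
    by (simp add: max_outdegree_prob_def prob_bounded_event)
qed

lemma truncated_fixed_point_max_outdegree_cdf:
  assumes "subcritical p"
  shows "truncated_fixed_point p (max_outdegree_cdf M \<tau>)"
proof
  show "max_outdegree_cdf M \<tau> m \<le> max_outdegree_cdf M \<tau> n" if "m \<le> n" for m n
    using finite_measure_mono[OF bounded_event_mono[OF that] bounded_event_measurable]
    by (simp add: prob_bounded_event)
qed (use assms max_outdegree_cdf_fixed_point in \<open>auto simp: max_outdegree_cdf_def\<close>)

end

section \<open>Limit behaviour of the maximal out-degree\<close>

theorem theorem3p3:
  fixes p :: "nat pmf" and M :: "'w measure" and \<tau> :: "'w \<Rightarrow> nat list set"
  assumes "subcritical p" and "unbounded p"
    and "galton_watson_tree M \<tau> p"
  shows "((\<lambda>n. max_outdegree_cdf M \<tau> n ^ n) \<longlonglongrightarrow> 1)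
    \<and> ((\<lambda>n. (1 - offspring_cdf p n) / (1 - max_outdegree_cdf M \<tau> n)) \<longlonglongrightarrow> 1 - offspring_mean p)
    \<and> ((\<lambda>j. let n = enumerate {n. pmf p n > 0} j in pmf p n / max_outdegree_prob M \<tau> n)
         \<longlonglongrightarrow> 1 - offspring_mean p)"
proof -
  interpret prob_space M using assms(3) by (simp add: galton_watson_tree_def)
  interpret galton_watson M \<tau> p by unfold_locales (rule assms(3))
  interpret truncated_fixed_point p "max_outdegree_cdf M \<tau>"
    by (rule truncated_fixed_point_max_outdegree_cdf[OF assms(1)])
  have inf: "infinite {n. pmf p n > 0}"
    using assms(2) by (auto simp: unbounded_def dest: bdd_above_finite)
  have "pmf p (enumerate {n. pmf p n > 0} j) > 0" for j
    using enumerate_in_set[OF inf, of j] by simp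
  then show ?thesis
    using H_power_tendsto_1 tail_ratio_tendsto[OF assms(2)]
      increment_ratio_tendsto[OF strict_mono_enumerate[OF inf] _ max_outdegree_prob_Suc]
    by (simp add: Let_def)
qed

end
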